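(* Let $T_1$ and $T_2$ be two trees. Then $\chi_s'(T_1\Box T_2)\le 2\Delta(T_1\Box T_2)$.
   Context: $\Delta(G)$ denotes the maximum degree of $G$. The Cartesian product $G\Box H$ has vertex set $V(G)\times V(H)$, with $(a,u)$ adjacent to $(b,v)$ iff either $a=b$ and $uv\in E(H)$, or $u=v$ and $ab\in E(G)$. A strong edge coloring of a graph is a proper edge coloring in which every color class is an induced matching; $\chi_s'(G)$, the strong chromatic index, is the minimum number of colors in a strong edge coloring of $G$. *)

theory Defs
  imports "Graph_Theory.Graph_Theory"
begin

text \<open>
  A finite simple undirected graph is a \<^locale>\<open>pair_graph\<close>: a finite, loopfree, symmetric
  digraph whose arcs are pairs of vertices. An undirected edge \<open>uv\<close> is therefore represented
  by the two arcs \<open>(u, v)\<close> and \<open>(v, u)\<close>; edge colorings are defined on the two-element sets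
  \<open>{u, v}\<close>, so that both arcs of an edge share one color.
\<close>

definition edges :: "'a pair_pre_digraph \<Rightarrow> 'a set set" where
  "edges G = {{u, v} | u v. (u, v) \<in> parcs G}"

text \<open>
  The library predicate \<^const>\<open>tree\<close> is for directed graphs: it rejects every symmetric digraph
  with an arc, because going along an arc and back is a \<^const>\<open>pre_digraph.cycle\<close> of length 2.
  In a \<^locale>\<open>pair_graph\<close> the cycles of the underlying undirected graph are exactly those of
  length at least 3. Connectedness includes that the vertex set is nonempty.
\<close>

definition undirected_tree :: "'a pair_pre_digraph \<Rightarrow> bool" where
  "undirected_tree G \<longleftrightarrow> pair_graph G \<and> Digraph_Component.connected (with_proj G) \<and>
     \<not> (\<exists>p. pre_digraph.cycle (with_proj G) p \<and> 3 \<le> length p)"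

text \<open>In a symmetric digraph the out-degree of a vertex is its degree in the undirected graph.\<close>

definition max_degree :: "'a pair_pre_digraph \<Rightarrow> nat" where
  "max_degree G = Max (out_degree (with_proj G) ` pverts G)"

definition cartesian_product ::
  "'a pair_pre_digraph \<Rightarrow> 'b pair_pre_digraph \<Rightarrow> ('a \<times> 'b) pair_pre_digraph" (infixr \<open>\<box>\<close> 70) where
  "G \<box> H = \<lparr> pverts = pverts G \<times> pverts H,
     parcs = {((a, u), (b, v)) | a u b v.
       (a, u) \<in> pverts G \<times> pverts H \<and> (b, v) \<in> pverts G \<times> pverts H \<and>
       (a = b \<and> (u, v) \<in> parcs H \<or> u = v \<and> (a, b) \<in> parcs G)} \<rparr>"

lemma pair_graph_cartesian_product:
  assumes "pair_graph G" and "pair_graph H"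
  shows "pair_graph (G \<box> H)"
proof -
  interpret G: pair_graph G by fact
  interpret H: pair_graph H by fact
  have fin: "finite (pverts (G \<box> H))"
    by (simp add: cartesian_product_def G.pair_finite_verts H.pair_finite_verts)
  have sub: "parcs (G \<box> H) \<subseteq> pverts (G \<box> H) \<times> pverts (G \<box> H)"
    by (auto simp: cartesian_product_def)
  have loops: "(x, x) \<notin> parcs G" "(y, y) \<notin> parcs H" for x y
    using G.pair_no_loops[of "(x, x)"] H.pair_no_loops[of "(y, y)"] by auto
  show ?thesis
  proof
    show "finite (parcs (G \<box> H))"
      using finite_subset[OF sub] fin by blast
    show "symmetric (with_proj (G \<box> H))"
      using G.pair_sym_arcs H.pair_sym_arcs
      by (auto simp: symmetric_def sym_def cartesian_product_def)
    show "fst e \<noteq> snd e" if "e \<in> parcs (G \<box> H)" for e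
      using that loops
      by (auto simp: cartesian_product_def)
  qed (use sub fin in auto)
qed

definition matching :: "'a pair_pre_digraph \<Rightarrow> 'a set set \<Rightarrow> bool" where
  "matching G M \<longleftrightarrow> M \<subseteq> edges G \<and> (\<forall>e\<in>M. \<forall>f\<in>M. e \<noteq> f \<longrightarrow> e \<inter> f = {})"

text \<open>The subgraph induced by the vertices covered by \<open>M\<close> has no edges other than those of \<open>M\<close>.\<close>

definition induced_matching :: "'a pair_pre_digraph \<Rightarrow> 'a set set \<Rightarrow> bool" where
  "induced_matching G M \<longleftrightarrow> matching G M \<and> {e \<in> edges G. e \<subseteq> \<Union>M} = M"

definition proper_edge_coloring :: "'a pair_pre_digraph \<Rightarrow> ('a set \<Rightarrow> nat) \<Rightarrow> bool" where
  "proper_edge_coloring G c \<longleftrightarrow>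
     (\<forall>e\<in>edges G. \<forall>f\<in>edges G. e \<noteq> f \<and> e \<inter> f \<noteq> {} \<longrightarrow> c e \<noteq> c f)"

definition strong_edge_coloring :: "'a pair_pre_digraph \<Rightarrow> ('a set \<Rightarrow> nat) \<Rightarrow> bool" where
  "strong_edge_coloring G c \<longleftrightarrow> proper_edge_coloring G c \<and>
     (\<forall>i. induced_matching G {e \<in> edges G. c e = i})"

definition strong_chromatic_index :: "'a pair_pre_digraph \<Rightarrow> nat" where
  "strong_chromatic_index G =
     (LEAST k. \<exists>c. strong_edge_coloring G c \<and> c ` edges G \<subseteq> {..<k})"

text \<open>The minimum is attained: giving all edges different colors is a strong edge coloring.\<close>

lemma strong_chromatic_index_attained:
  assumes "pair_graph G"
  shows "\<exists>c. strong_edge_coloring G c \<and> c ` edges G \<subseteq> {..<strong_chromatic_index G}"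
proof -
  interpret pair_graph G by fact
  have "edges G = (\<lambda>(u, v). {u, v}) ` parcs G"
    by (auto simp: edges_def)
  then have "finite (edges G)"
    using pair_finite_arcs by simp
  then obtain c :: "'a set \<Rightarrow> nat" and n where c: "c ` edges G = {i. i < n}" "inj_on c (edges G)"
    using finite_imp_inj_to_nat_seg[of "edges G"] by metis
  have edge_eq: "e = f" if "e \<in> edges G" "f \<in> edges G" "e \<subseteq> f" for e f
  proof -
    obtain u v where "e = {u, v}" "(u, v) \<in> parcs G"
      using \<open>e \<in> edges G\<close> by (auto simp: edges_def)
    moreover from this have "u \<noteq> v"
      using pair_no_loops[of "(u, v)"] by simp
    moreover obtain x y where "f = {x, y}"
      using \<open>f \<in> edges G\<close> by (auto simp: edges_def)
    ultimately show ?thesis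
      using \<open>e \<subseteq> f\<close> by auto
  qed
  have ne: "e \<noteq> {}" if "e \<in> edges G" for e
    using that by (auto simp: edges_def)
  have "induced_matching G {e \<in> edges G. c e = i}" for i
  proof (cases "\<exists>f\<in>edges G. c f = i")
    case True
    then obtain f where f: "f \<in> edges G" "c f = i" by blast
    then have "{e \<in> edges G. c e = i} = {f}"
      using c(2) by (auto simp: inj_on_def)
    then show ?thesis
      using f edge_eq by (simp add: induced_matching_def matching_def) blast
  next
    case False
    then have "{e \<in> edges G. c e = i} = {}" by blast
    then show ?thesis
      using ne by (auto simp: induced_matching_def matching_def)
  qed
  then have "strong_edge_coloring G c"
    using c(2) by (auto simp: strong_edge_coloring_def proper_edge_coloring_def inj_on_def)
  then have "\<exists>k c. strong_edge_coloring G c \<and> c ` edges G \<subseteq> {..<k}"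
    using c(1) by blast
  then show ?thesis
    unfolding strong_chromatic_index_def by (rule LeastI_ex)
qed

end

theory Submission
  imports Defs
begin

text \<open>
  A proper edge coloring \<open>c\<close> of a tree with \<open>\<Delta>\<close> colors comes with a two-coloring \<open>p k\<close> of the
  vertices for every color \<open>k\<close>, whose value changes exactly along the edges not colored \<open>k\<close> (it
  exists because contracting the edges of color \<open>k\<close> leaves a bipartite graph). In the product, a
  copy of the edge \<open>ab\<close> of the first tree over the vertex \<open>u\<close> of the second one gets the color
  \<open>k = c(ab)\<close> together with the parity of \<open>p k a\<close> plus the bipartition class of \<open>u\<close>, and likewise
  with the roles exchanged and \<open>2\<Delta>\<close> fresh colors. Two copies with equal \<open>k\<close> that are joined by an
  edge of the product have different parities: the joining edge either lies in the second tree
  and changes the class of \<open>u\<close>, or it lies in the first tree, where its color is not \<open>k\<close> because \<open>c\<close>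
  is proper, and then changes \<open>p k\<close>.
\<close>

section \<open>Maximum degree of a Cartesian product\<close>

lemma out_degree_le_max_degree:
  assumes "finite (pverts G)" and "v \<in> pverts G"
  shows "out_degree (with_proj G) v \<le> max_degree G"
  using assms by (simp add: max_degree_def)

lemma out_degree_with_proj:
  "out_degree (with_proj G) v = card {w. (v, w) \<in> parcs G}"
proof -
  have "out_arcs (with_proj G) v = Pair v ` {w. (v, w) \<in> parcs G}"
    by (auto simp: out_arcs_def)
  then show ?thesis
    by (simp add: out_degree_def card_image inj_on_def)
qed

lemma (in pair_graph) max_degree_attained:
  assumes "pverts G \<noteq> {}"
  obtains v where "v \<in> pverts G" "out_degree (with_proj G) v = max_degree G"
proof -
  have "max_degree G \<in> out_degree (with_proj G) ` pverts G"
    unfolding max_degree_def using assms pair_finite_verts by (intro Max_in) auto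
  then show ?thesis
    using that by auto
qed

text \<open>Witnessed by a pair of vertices of maximum degree: its neighbours lie in the two fibres
  through it. This turns a bound by the degrees of the factors into one by the degree of the
  product.\<close>

lemma max_degree_cartesian_product_ge:
  assumes "pair_graph G" "pair_graph H" "pverts G \<noteq> {}" "pverts H \<noteq> {}"
  shows "max_degree G + max_degree H \<le> max_degree (G \<box> H)"
proof -
  interpret G: pair_graph G by fact
  interpret H: pair_graph H by fact
  interpret GH: pair_graph "G \<box> H" by (rule pair_graph_cartesian_product) fact+
  obtain a where a: "a \<in> pverts G" "out_degree (with_proj G) a = max_degree G"
    using G.max_degree_attained assms by blast
  obtain u where u: "u \<in> pverts H" "out_degree (with_proj H) u = max_degree H"
    using H.max_degree_attained assms by blast
  have fin: "finite {b. (a, b) \<in> parcs G}" "finite {v. (u, v) \<in> parcs H}"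
    using finite_subset[OF _ G.pair_finite_verts] finite_subset[OF _ H.pair_finite_verts]
      G.in_arcsD2 H.in_arcsD2 by (metis mem_Collect_eq subsetI)+
  have "{x. ((a, u), x) \<in> parcs (G \<box> H)} =
      (\<lambda>b. (b, u)) ` {b. (a, b) \<in> parcs G} \<union> Pair a ` {v. (u, v) \<in> parcs H}"
    using a u G.in_arcsD2 H.in_arcsD2 by (auto simp: cartesian_product_def)
  \<comment> \<open>A common element would be \<open>(a, u)\<close> itself, hence a loop of
    \<open>G\<close> at \<open>a\<close>.\<close>
  moreover have "(\<lambda>b. (b, u)) ` {b. (a, b) \<in> parcs G} \<inter> Pair a ` {v. (u, v) \<in> parcs H} = {}"
    using G.pair_no_loops by force
  ultimately have "out_degree (with_proj (G \<box> H)) (a, u) = max_degree G + max_degree H"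
    using fin a(2) u(2)
    by (simp add: out_degree_with_proj card_Un_disjoint card_image inj_on_def)
  moreover have "(a, u) \<in> pverts (G \<box> H)"
    using a u by (simp add: cartesian_product_def)
  ultimately show ?thesis
    using out_degree_le_max_degree[OF GH.pair_finite_verts] by metis
qed

section \<open>Growing a tree leaf by leaf\<close>

lemma (in pair_graph) arc_leaving_set:
  assumes "Digraph_Component.connected (with_proj G)"
    and "S \<subseteq> pverts G" "S \<noteq> {}" "S \<noteq> pverts G"
  obtains y x where "y \<in> S" "x \<in> pverts G" "x \<notin> S" "(y, x) \<in> parcs G"
proof -
  obtain r z where r: "r \<in> S" and z: "z \<in> pverts G" "z \<notin> S"
    using assms by blast
  have "strongly_connected (with_proj G)"
    using symmetric_connected_imp_strongly_connected pair_sym_arcs assms(1) by blast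
  then have "r \<rightarrow>\<^sup>*\<^bsub>with_proj G\<^esub> z"
    using r z assms(2) by (auto simp: strongly_connected_def)
  \<comment> \<open>Invariant along a walk starting in \<open>S\<close>: its end is still in
    \<open>S\<close>, or an arc leaving \<open>S\<close> exists.\<close>
  then have "z \<in> S \<or> (\<exists>y x. y \<in> S \<and> x \<in> pverts G \<and> x \<notin> S \<and> (y, x) \<in> parcs G)"
    unfolding reachable_def
  proof (induction rule: rtrancl_on_induct)
    case base
    then show ?case using r by blast
  next
    case (step y z)
    then show ?case by auto
  qed
  then show ?thesis using z that by blast
qed

lemma (in pair_graph) apath_snoc:
  assumes "apath u p y" "(y, x) \<in> parcs G" "x \<notin> set (pawalk_verts u p)"
  shows "apath u (p @ [(y, x)]) x"
    and "set (pawalk_verts u (p @ [(y, x)])) = insert x (set (pawalk_verts u p))"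
proof -
  have p: "awalk u p y"
    using assms(1) by (simp add: apath_def)
  then have last: "last (pawalk_verts u p) = y"
    using awlast_of_awalk by blast
  show "apath u (p @ [(y, x)]) x"
    using assms last in_arcsD2 by (auto simp: apath_append_iff apath_simps)
  then show "set (pawalk_verts u (p @ [(y, x)])) = insert x (set (pawalk_verts u p))"
    using awalk_verts_append[of u p "[(y, x)]" x] last by (auto simp: apath_def)
qed

text \<open>A vertex outside a connected set \<open>S\<close> cannot have two neighbours in
  \<open>S\<close>, since a path in \<open>S\<close> between them would close a cycle. So each
  vertex added next to \<open>S\<close> is a leaf.\<close>

lemma undirected_tree_induct [consumes 1, case_names singleton insert]:
  assumes "undirected_tree G"
    and singleton: "\<And>r. r \<in> pverts G \<Longrightarrow> P {r}"
    and insert: "\<And>S x y. S \<subseteq> pverts G \<Longrightarrow> x \<in> pverts G \<Longrightarrow> x \<notin> S \<Longrightarrow> y \<in> S \<Longrightarrow> (y, x) \<in> parcs G \<Longrightarrow>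
      (\<And>z. z \<in> S \<Longrightarrow> (z, x) \<in> parcs G \<Longrightarrow> z = y) \<Longrightarrow> P S \<Longrightarrow> P (insert x S)"
  shows "P (pverts G)"
proof -
  have pg: "pair_graph G" and conn: "Digraph_Component.connected (with_proj G)"
    and acyc: "\<And>p. pre_digraph.cycle (with_proj G) p \<Longrightarrow> length p < 3"
    using assms(1) by (auto simp: undirected_tree_def not_le)
  interpret pair_graph G by fact
  \<comment> \<open>Connectedness of the subgraph induced by \<open>S\<close>, in terms of simple
    paths, which are what is needed to close a cycle.\<close>
  define linked where "linked S \<longleftrightarrow>
    (\<forall>u\<in>S. \<forall>v\<in>S. \<exists>p. apath u p v \<and> set (pawalk_verts u p) \<subseteq> S)" for S
  define \<C> where "\<C> = {S. S \<subseteq> pverts G \<and> S \<noteq> {} \<and> linked S \<and> P S}"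
  obtain r where r: "r \<in> pverts G"
    using conn connected_conv[of "with_proj G"] by auto
  have "linked {r}"
    unfolding linked_def using r by (auto intro!: exI[of _ "[]"] simp: apath_Nil_iff)
  then have "{r} \<in> \<C>"
    using singleton r by (simp add: \<C>_def)
  moreover have "finite \<C>"
    unfolding \<C>_def using pair_finite_verts by simp
  ultimately obtain S where S: "S \<in> \<C>" and max: "\<And>S'. S' \<in> \<C> \<Longrightarrow> S \<subseteq> S' \<Longrightarrow> S = S'"
    using finite_has_maximal[of \<C>] by blast
  \<comment> \<open>Maximality replaces an explicit growing sequence: if \<open>S\<close> misses a
    vertex, an arc leaving \<open>S\<close> allows it to be enlarged within
    \<open>\<C>\<close>.\<close>
  have "S = pverts G"
  proof (rule ccontr)
    assume "S \<noteq> pverts G"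
    then obtain y x where yx: "y \<in> S" "x \<in> pverts G" "x \<notin> S" "(y, x) \<in> parcs G"
      using arc_leaving_set[OF conn] S by (auto simp: \<C>_def)
    then have xy: "(x, y) \<in> parcs G"
      using arcs_symmetric by blast
    have path: "\<exists>p. apath u p v \<and> set (pawalk_verts u p) \<subseteq> S" if "u \<in> S" "v \<in> S" for u v
      using S that by (auto simp: \<C>_def linked_def)
    have unique: "z = y" if z: "z \<in> S" "(z, x) \<in> parcs G" for z
    proof (rule ccontr)
      assume "z \<noteq> y"
      obtain p where p: "apath y p z" "set (pawalk_verts y p) \<subseteq> S"
        using path yx(1) z(1) by blast
      then have "p \<noteq> []"
        using \<open>z \<noteq> y\<close> by (auto simp: apath_Nil_iff)
      note snoc = apath_snoc[OF p(1) z(2)]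
      have x: "x \<notin> set (pawalk_verts y p)"
        using p(2) yx(3) by blast
      have walk: "awalk x ((x, y) # p @ [(z, x)]) x"
        using snoc(1)[OF x] xy by (simp add: awalk_Cons_iff apath_def del: awalk_append_iff)
      have "distinct (pawalk_verts y (p @ [(z, x)]))"
        using snoc(1)[OF x] by (simp add: apath_def)
      with walk have "cycle ((x, y) # p @ [(z, x)])"
        unfolding cycle_def by (intro exI[of _ x]) (simp del: awalk_append_iff)
      \<comment> \<open>As \<open>p\<close> is nonempty, the cycle has length at least 3 and is not
        just an arc traversed back and forth.\<close>
      from acyc[OF this] show False
        using \<open>p \<noteq> []\<close> by (cases p) auto
    qed
    have "linked (insert x S)"
      unfolding linked_def
    proof (intro ballI)
      fix u v assume uv: "u \<in> insert x S" "v \<in> insert x S"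
      consider "u = x" "v = x" | "u = x" "v \<in> S" | "u \<in> S" "v = x" | "u \<in> S" "v \<in> S"
        using uv by blast
      then show "\<exists>p. apath u p v \<and> set (pawalk_verts u p) \<subseteq> insert x S"
      proof cases
        case 1
        then show ?thesis using yx(2) by (auto intro!: exI[of _ "[]"] simp: apath_Nil_iff)
      next
        case 2
        then obtain p where "apath y p v" "set (pawalk_verts y p) \<subseteq> S"
          using path yx(1) by blast
        then show ?thesis
          using 2 xy yx(3) by (intro exI[of _ "(x, y) # p"]) (auto simp: apath_Cons_iff)
      next
        case 3
        then obtain p where p: "apath u p y" "set (pawalk_verts u p) \<subseteq> S"
          using path yx(1) by blast
        then have "x \<notin> set (pawalk_verts u p)"
          using yx(3) by blast
        then show ?thesis
          using apath_snoc[OF p(1) yx(4)] p(2) 3 by blast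
      next
        case 4
        then show ?thesis using path by blast
      qed
    qed
    moreover have "S \<subseteq> pverts G" "P S"
      using S by (simp_all add: \<C>_def)
    then have "P (insert x S)"
      using insert[OF _ yx(2,3,1,4) unique] by blast
    ultimately have "insert x S \<in> \<C>"
      using S yx(2) by (simp add: \<C>_def)
    then show False
      using max yx(3) by blast
  qed
  then show ?thesis
    using S by (simp add: \<C>_def)
qed

section \<open>Parity colorings of trees\<close>

text \<open>\<open>E\<close> is a bare relation so that it can be the arcs inside a growing vertex
  set. Colors are read off ordered pairs, hence the symmetry condition. The index \<open>k\<close>
  is unbounded: for \<open>k \<ge> d\<close>, \<open>p k\<close> is a bipartition.\<close>

definition parity_coloring ::
  "'a rel \<Rightarrow> nat \<Rightarrow> ('a \<Rightarrow> 'a \<Rightarrow> nat) \<Rightarrow> (nat \<Rightarrow> 'a \<Rightarrow> bool) \<Rightarrow> bool" where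
  "parity_coloring E d c p \<longleftrightarrow>
     (\<forall>x y. (x, y) \<in> E \<longrightarrow> c x y = c y x \<and> c x y < d \<and> (\<forall>k. p k x = p k y \<longleftrightarrow> c x y = k)) \<and>
     (\<forall>x y z. (x, y) \<in> E \<longrightarrow> (x, z) \<in> E \<longrightarrow> c x y = c x z \<longrightarrow> y = z)"

lemma parity_coloringD:
  assumes "parity_coloring E d c p" "(x, y) \<in> E"
  shows "c x y = c y x" "c x y < d" "p k x = p k y \<longleftrightarrow> c x y = k"
    "(x, z) \<in> E \<Longrightarrow> c x y = c x z \<Longrightarrow> y = z"
  using assms unfolding parity_coloring_def by blast+

text \<open>The new edge takes a color free at \<open>y\<close>; as \<open>x\<close> has no other
  edge, each \<open>p k\<close> can be set at \<open>x\<close> without conflict.\<close>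

lemma parity_coloring_add_leaf:
  assumes E: "parity_coloring E d c p"
    and x: "x \<notin> Field E" "x \<noteq> y"
    and col: "col < d" "col \<notin> c y ` (E `` {y})"
  shows "\<exists>c p. parity_coloring (insert (x, y) (insert (y, x) E)) d c p"
proof (intro exI)
  define c' where "c' v w = (if v = x \<or> w = x then col else c v w)" for v w
  \<comment> \<open>The value at \<open>x\<close> is that at \<open>y\<close> if
    \<open>k = col\<close>, and its negation otherwise.\<close>
  define p' where "p' k v = (if v = x then p k y \<longleftrightarrow> k = col else p k v)" for k v
  have ne: "v \<noteq> x \<and> w \<noteq> x" if "(v, w) \<in> E" for v w
    using x(1) that by (auto simp: Field_def)
  have free: "c y w \<noteq> col" if "(y, w) \<in> E" for w
    using col(2) that by auto
  show "parity_coloring (insert (x, y) (insert (y, x) E)) d c' p'"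
    unfolding parity_coloring_def
  proof (intro conjI allI impI)
    fix v w assume "(v, w) \<in> insert (x, y) (insert (y, x) E)"
    then consider "v = x" "w = y" | "v = y" "w = x" | "(v, w) \<in> E"
      by blast
    then have "c' v w = c' w v \<and> c' v w < d \<and> (\<forall>k. p' k v = p' k w \<longleftrightarrow> c' v w = k)"
    proof cases
      case 3
      then show ?thesis
        using parity_coloringD(1-3)[OF E 3] ne[OF 3] by (simp add: c'_def p'_def)
    qed (use x(2) col(1) in \<open>auto simp: c'_def p'_def\<close>)
    then show "c' v w = c' w v" "c' v w < d" "p' k v = p' k w \<longleftrightarrow> c' v w = k" for k
      by blast+
  next
    fix v w z
    assume vw: "(v, w) \<in> insert (x, y) (insert (y, x) E)" "(v, z) \<in> insert (x, y) (insert (y, x) E)"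
      and eq: "c' v w = c' v z"
    show "w = z"
    proof (cases "v = x \<or> w = x \<or> z = x")
      case True
      then show ?thesis
        using vw eq ne[of v w] ne[of v z] free[of w] free[of z] x(2)
        by (auto simp: c'_def split: if_splits)
    next
      case False
      then show ?thesis
        using vw eq parity_coloringD(4)[OF E] by (auto simp: c'_def)
    qed
  qed
qed

text \<open>Greedy coloring along the leaf-by-leaf construction, applied to the arcs inside the
  current vertex set.\<close>

lemma undirected_tree_parity_coloring:
  assumes "undirected_tree G"
  shows "\<exists>c p. parity_coloring (parcs G) (max_degree G) c p"
proof -
  interpret pair_graph G
    using assms by (simp add: undirected_tree_def)
  have loop: "(x, x) \<notin> parcs G" for x
    using pair_no_loops by fastforce
  have "\<exists>c p. parity_coloring (parcs G \<inter> pverts G \<times> pverts G) (max_degree G) c p"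
    using assms
  proof (induction rule: undirected_tree_induct)
    case (singleton r)
    have "parcs G \<inter> {r} \<times> {r} = {}"
      using loop by auto
    then show ?case
      by (simp add: parity_coloring_def)
  next
    case (insert S x y)
    then obtain c p where cp: "parity_coloring (parcs G \<inter> S \<times> S) (max_degree G) c p"
      by blast
    have yx: "(y, x) \<in> parcs G" "(x, y) \<in> parcs G"
      using insert arcs_symmetric by blast+
    define N where "N = {z. (y, z) \<in> parcs G}"
    have "N \<subseteq> pverts G"
      using in_arcsD2 by (auto simp: N_def)
    then have fin: "finite N"
      using pair_finite_verts by (rule finite_subset)
    \<comment> \<open>The neighbour \<open>x\<close> of \<open>y\<close> is outside
      \<open>S\<close>, so fewer than \<open>max_degree G\<close> colors occur at \<open>y\<close>
      so far and one is free.\<close>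
    have "N \<inter> S \<subset> N"
      using yx \<open>x \<notin> S\<close> by (auto simp: N_def)
    then have "card (c y ` (N \<inter> S)) < card N"
      using fin card_image_le[of "N \<inter> S" "c y"] psubset_card_mono[of N "N \<inter> S"] by simp
    also have "\<dots> \<le> max_degree G"
      using out_degree_le_max_degree[OF pair_finite_verts, of y] insert(1,4)
      by (auto simp: out_degree_with_proj N_def)
    finally have "\<not> {..<max_degree G} \<subseteq> c y ` (N \<inter> S)"
      using fin card_mono[of "c y ` (N \<inter> S)" "{..<max_degree G}"] by auto
    then obtain col where col: "col < max_degree G" "col \<notin> c y ` (N \<inter> S)"
      by blast
    have leaf: "z = y" if "z \<in> S" "(z, x) \<in> parcs G \<or> (x, z) \<in> parcs G" for z
      using insert(6) that arcs_symmetric by blast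
    \<comment> \<open>Since \<open>y\<close> is the only neighbour of \<open>x\<close> in
      \<open>S\<close>, just the two orientations of one edge are new.\<close>
    have "parcs G \<inter> insert x S \<times> insert x S =
        Set.insert (x, y) (Set.insert (y, x) (parcs G \<inter> S \<times> S))"
      by (intro equalityI subrelI) (use yx loop[of x] leaf \<open>y \<in> S\<close> in blast)+
    moreover have "\<exists>c p. parity_coloring
        (Set.insert (x, y) (Set.insert (y, x) (parcs G \<inter> S \<times> S))) (max_degree G) c p"
    proof (rule parity_coloring_add_leaf[OF cp _ _ col(1)])
      show "x \<notin> Field (parcs G \<inter> S \<times> S)" "x \<noteq> y"
        using \<open>x \<notin> S\<close> \<open>y \<in> S\<close> by (auto simp: Field_def)
      show "col \<notin> c y ` ((parcs G \<inter> S \<times> S) `` {y})"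
        using col(2) by (auto simp: N_def)
    qed
    ultimately show ?case
      by (simp only:)
  qed
  moreover have "parcs G \<inter> pverts G \<times> pverts G = parcs G"
    using in_arcsD1 in_arcsD2 by auto
  ultimately show ?thesis
    by simp
qed

section \<open>From colors of arcs to a strong edge coloring\<close>

text \<open>Properness and inducedness both concern edges having equal or adjacent ends. Arcs come
  in both orientations, so comparing only the tails in \<open>strong\<close> covers every pair of
  ends.\<close>

lemma strong_chromatic_index_le:
  assumes "pair_graph G"
    and sym: "\<And>x y. (x, y) \<in> parcs G \<Longrightarrow> g x y = g y x"
    and bound: "\<And>x y. (x, y) \<in> parcs G \<Longrightarrow> g x y < k"
    and strong: "\<And>x y x' y'. (x, y) \<in> parcs G \<Longrightarrow> (x', y') \<in> parcs G \<Longrightarrow> g x y = g x' y' \<Longrightarrow>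
      x = x' \<or> (x, x') \<in> parcs G \<Longrightarrow> {x, y} = {x', y'}"
  shows "strong_chromatic_index G \<le> k"
proof -
  interpret pair_graph G by fact
  \<comment> \<open>Well defined on edges, because \<open>sym\<close> gives both orientations the
    same value.\<close>
  define c where "c e = (THE i. \<exists>x y. e = {x, y} \<and> (x, y) \<in> parcs G \<and> i = g x y)" for e
  have c: "c {x, y} = g x y" if "(x, y) \<in> parcs G" for x y
    unfolding c_def using that sym[OF that]
    by (intro the_equality) (fastforce, auto simp: doubleton_eq_iff)
  have edge_at: "\<exists>y. (x, y) \<in> parcs G \<and> e = {x, y}" if e: "e \<in> edges G" and x: "x \<in> e" for e x
  proof -
    obtain u v where "e = {u, v}" "(u, v) \<in> parcs G"
      using e by (auto simp: edges_def)
    then show ?thesis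
      using x arcs_symmetric[of u v] by auto
  qed
  have same: "e = f"
    if e: "e \<in> edges G" "x \<in> e" and f: "f \<in> edges G" "x' \<in> f"
      and "c e = c f" "x = x' \<or> (x, x') \<in> parcs G"
    for e f x x'
  proof -
    obtain y y' where "(x, y) \<in> parcs G" "e = {x, y}" "(x', y') \<in> parcs G" "f = {x', y'}"
      using edge_at[OF e] edge_at[OF f] by blast
    then show ?thesis
      using strong[of x y x' y'] that(5,6) c by simp
  qed
  have proper: "c e \<noteq> c f"
    if "e \<in> edges G" "f \<in> edges G" "e \<noteq> f" "z \<in> e" "z \<in> f" for e f z
    using same[of e z f z] that by blast
  have "induced_matching G {e \<in> edges G. c e = i}" for i
  proof -
    let ?M = "{e \<in> edges G. c e = i}"
    have "matching G ?M"
      unfolding matching_def using proper by blast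
    \<comment> \<open>The ends of \<open>d\<close> are adjacent and covered by edges
      \<open>e\<close> and \<open>f\<close> of the class; hence \<open>e = f\<close> contains both
      ends and equals \<open>d\<close>.\<close>
    moreover have "d \<in> ?M" if d: "d \<in> edges G" "d \<subseteq> \<Union>?M" for d
    proof -
      obtain x y where xy: "d = {x, y}" "(x, y) \<in> parcs G"
        using d(1) by (auto simp: edges_def)
      obtain e f where ef: "e \<in> ?M" "f \<in> ?M" "x \<in> e" "y \<in> f"
        using d(2) xy(1) by auto
      then have "e = f"
        using same[of e x f y] xy(2) by simp
      moreover have "x \<noteq> y"
        using pair_no_loops xy(2) by fastforce
      ultimately have "e = d"
        using edge_at[of e x] ef xy(1) by auto
      then show ?thesis using ef by simp
    qed
    ultimately show ?thesis
      unfolding induced_matching_def by blast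
  qed
  moreover have "proper_edge_coloring G c"
    unfolding proper_edge_coloring_def using proper by blast
  moreover have "c ` edges G \<subseteq> {..<k}"
    using c bound by (auto simp: edges_def)
  ultimately have "\<exists>c. strong_edge_coloring G c \<and> c ` edges G \<subseteq> {..<k}"
    unfolding strong_edge_coloring_def by blast
  then show ?thesis
    unfolding strong_chromatic_index_def by (rule Least_le)
qed

section \<open>The coloring of the product\<close>

theorem theorem4:
  fixes T1 :: "'a pair_pre_digraph" and T2 :: "'b pair_pre_digraph"
  assumes "undirected_tree T1" and "undirected_tree T2"
  shows "strong_chromatic_index (T1 \<box> T2) \<le> 2 * max_degree (T1 \<box> T2)"
proof -
  let ?D1 = "max_degree T1" and ?D2 = "max_degree T2"
  interpret T1: pair_graph T1 using assms(1) by (simp add: undirected_tree_def)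
  interpret T2: pair_graph T2 using assms(2) by (simp add: undirected_tree_def)
  have ne: "pverts T1 \<noteq> {}" "pverts T2 \<noteq> {}"
    using assms connected_conv[of "with_proj T1"] connected_conv[of "with_proj T2"]
    by (simp_all add: undirected_tree_def)
  have pg: "pair_graph (T1 \<box> T2)"
    by (rule pair_graph_cartesian_product) unfold_locales
  obtain c1 p1 where cp1: "parity_coloring (parcs T1) ?D1 c1 p1"
    using undirected_tree_parity_coloring[OF assms(1)] by blast
  note c1 = parity_coloringD(1,2,4)[OF cp1] and p1 = parity_coloringD(3)[OF cp1]
  obtain c2 p2 where cp2: "parity_coloring (parcs T2) ?D2 c2 p2"
    using undirected_tree_parity_coloring[OF assms(2)] by blast
  note c2 = parity_coloringD(1,2,4)[OF cp2] and p2 = parity_coloringD(3)[OF cp2]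
  have loop2: "(u, u) \<notin> parcs T2" for u
    using T2.pair_no_loops by fastforce
  \<comment> \<open>Decodes a tree color and a parity bit from a single number.\<close>
  have double_add_bit: "m = n \<and> P = Q" if "2 * m + of_bool P = 2 * n + of_bool Q"
    for m n :: nat and P Q
    using that by (auto simp: of_bool_def split: if_splits; presburger)
  \<comment> \<open>The color \<open>?D1\<close> is not used by \<open>c1\<close>, so \<open>p1 ?D1\<close> is a bipartition of \<open>T1\<close>; likewise for \<open>T2\<close>.\<close>
  define g where "g x y = (case (x, y) of ((a, u), (b, v)) \<Rightarrow>
    if u = v then 2 * c1 a b + of_bool (p1 (c1 a b) a \<noteq> p2 ?D2 u)
    else 2 * ?D1 + (2 * c2 u v + of_bool (p2 (c2 u v) u \<noteq> p1 ?D1 a)))" for x y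
  have g1: "g (a, u) (b, u) = 2 * c1 a b + of_bool (p1 (c1 a b) a \<noteq> p2 ?D2 u)" for a b u
    by (simp add: g_def)
  have g2: "g (a, u) (a, v) = 2 * ?D1 + (2 * c2 u v + of_bool (p2 (c2 u v) u \<noteq> p1 ?D1 a))"
    if "(u, v) \<in> parcs T2" for a u v
    using that loop2 by (auto simp: g_def)
  have g1_less: "g (a, u) (b, u) < 2 * ?D1" if "(a, b) \<in> parcs T1" for a b u
    using c1(2)[OF that] by (simp add: g1 of_bool_def)
  have g2_not_less: "\<not> g (a, u) (a, v) < 2 * ?D1" if "(u, v) \<in> parcs T2" for a u v
    by (simp add: g2[OF that])
  have product_arc: "(\<exists>a b u. x = (a, u) \<and> y = (b, u) \<and> (a, b) \<in> parcs T1) \<or>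
      (\<exists>a u v. x = (a, u) \<and> y = (a, v) \<and> (u, v) \<in> parcs T2)"
    if "(x, y) \<in> parcs (T1 \<box> T2)" for x y
    using that by (auto simp: cartesian_product_def)
  have class1: "p1 ?D1 a \<noteq> p1 ?D1 a'" if "(a, a') \<in> parcs T1" for a a'
    using p1[OF that] c1(2)[OF that] by simp
  have class2: "p2 ?D2 u \<noteq> p2 ?D2 u'" if "(u, u') \<in> parcs T2" for u u'
    using p2[OF that] c2(2)[OF that] by simp
  have "strong_chromatic_index (T1 \<box> T2) \<le> 2 * ?D1 + 2 * ?D2"
    using pg
  proof (rule strong_chromatic_index_le[where g = g])
    \<comment> \<open>Reversal keeps the parity bit, as \<open>p1 k\<close> and \<open>p2 k\<close>
      agree at the ends of an edge colored \<open>k\<close>.\<close>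
    show "g x y = g y x" if "(x, y) \<in> parcs (T1 \<box> T2)" for x y
      using product_arc[OF that]
    proof (elim disjE exE conjE)
      fix a b u assume "x = (a, u)" "y = (b, u)" and ab: "(a, b) \<in> parcs T1"
      then show ?thesis
        using c1(1)[OF ab] p1[OF ab, of "c1 a b"] by (simp add: g1)
    next
      fix a u v assume "x = (a, u)" "y = (a, v)" and uv: "(u, v) \<in> parcs T2"
      then show ?thesis
        using c2(1)[OF uv] p2[OF uv, of "c2 u v"] T2.arcs_symmetric[OF uv] by (simp add: g2)
    qed
    show "g x y < 2 * ?D1 + 2 * ?D2" if "(x, y) \<in> parcs (T1 \<box> T2)" for x y
      using product_arc[OF that]
    proof (elim disjE exE conjE)
      fix a b u assume "x = (a, u)" "y = (b, u)" "(a, b) \<in> parcs T1"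
      then show ?thesis
        using g1_less[of a b u] by simp
    next
      fix a u v assume "x = (a, u)" "y = (a, v)" and uv: "(u, v) \<in> parcs T2"
      then show ?thesis
        using c2(2)[OF uv] by (simp add: g2 of_bool_def)
    qed
    fix x y x' y'
    assume arcs: "(x, y) \<in> parcs (T1 \<box> T2)" "(x', y') \<in> parcs (T1 \<box> T2)"
      and eq: "g x y = g x' y'" and near: "x = x' \<or> (x, x') \<in> parcs (T1 \<box> T2)"
    consider a b u where "x = (a, u)" "y = (b, u)" "(a, b) \<in> parcs T1"
      | a u v where "x = (a, u)" "y = (a, v)" "(u, v) \<in> parcs T2"
      using product_arc[OF arcs(1)] by blast
    then show "{x, y} = {x', y'}"
    proof cases
      case (1 a b u)
      \<comment> \<open>The range of the color tells the factor, so the second arc also copies an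
        edge of \<open>T1\<close>.\<close>
      then have "g x' y' < 2 * ?D1"
        using eq g1_less[of a b u] by simp
      then obtain a' b' u' where x': "x' = (a', u')" "y' = (b', u')" "(a', b') \<in> parcs T1"
        using product_arc[OF arcs(2)] g2_not_less by blast
      have k: "c1 a b = c1 a' b'"
        and parity: "(p1 (c1 a b) a \<noteq> p2 ?D2 u) = (p1 (c1 a b) a' \<noteq> p2 ?D2 u')"
        using double_add_bit[OF eq[unfolded 1 x' g1]] by auto
      have "u = u' \<and> (a = a' \<or> (a, a') \<in> parcs T1) \<or> a = a' \<and> (u, u') \<in> parcs T2"
        using near by (auto simp: 1 x' cartesian_product_def)
      \<comment> \<open>A joining arc in \<open>T2\<close> would flip only the class of
        \<open>u\<close>, against \<open>parity\<close>. One in \<open>T1\<close> must leave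
        \<open>p1 k\<close> unchanged, so its color is \<open>k = c1 a b\<close>.\<close>
      then have u: "u = u'" and a: "a = a' \<or> (a, a') \<in> parcs T1 \<and> c1 a a' = c1 a b"
        using class2[of u u'] parity p1[of a a' "c1 a b"] by auto
      from a show ?thesis
      proof
        assume "a = a'"
        then show ?thesis using c1(3)[of a b b'] 1 x' k u by simp
      next
        assume aa': "(a, a') \<in> parcs T1 \<and> c1 a a' = c1 a b"
        \<comment> \<open>Properness at \<open>a\<close> and at \<open>a'\<close> identifies the
          joining edge with both given edges, which are thus opposite orientations of one
          edge.\<close>
        then have "b = a'" "a = b'"
          using c1(3)[of a a' b] c1(3)[of a' a b'] c1(1)[of a a'] T1.arcs_symmetric[of a a'] 1 x' k
          by auto
        then show ?thesis using 1 x' u by auto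
      qed
    next
      case (2 a u v)
      \<comment> \<open>The same argument with the factors exchanged; the offset
        \<open>2 * ?D1\<close> cancels in \<open>eq\<close>.\<close>
      then have "\<not> g x' y' < 2 * ?D1"
        using eq g2_not_less[of u v a] by simp
      then obtain a' u' v' where x': "x' = (a', u')" "y' = (a', v')" "(u', v') \<in> parcs T2"
        using product_arc[OF arcs(2)] g1_less by blast
      have k: "c2 u v = c2 u' v'"
        and parity: "(p2 (c2 u v) u \<noteq> p1 ?D1 a) = (p2 (c2 u v) u' \<noteq> p1 ?D1 a')"
        using double_add_bit[OF eq[unfolded 2(1,2) x'(1,2) g2[OF 2(3)] g2[OF x'(3)] add_left_cancel]]
        by auto
      have "a = a' \<and> (u = u' \<or> (u, u') \<in> parcs T2) \<or> u = u' \<and> (a, a') \<in> parcs T1"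
        using near by (auto simp: 2 x' cartesian_product_def)
      then have a: "a = a'" and u: "u = u' \<or> (u, u') \<in> parcs T2 \<and> c2 u u' = c2 u v"
        using class1[of a a'] parity p2[of u u' "c2 u v"] by auto
      from u show ?thesis
      proof
        assume "u = u'"
        then show ?thesis using c2(3)[of u v v'] 2 x' k a by simp
      next
        assume uu': "(u, u') \<in> parcs T2 \<and> c2 u u' = c2 u v"
        then have "v = u'" "u = v'"
          using c2(3)[of u u' v] c2(3)[of u' u v'] c2(1)[of u u'] T2.arcs_symmetric[of u u'] 2 x' k
          by auto
        then show ?thesis using 2 x' a by auto
      qed
    qed
  qed
  also have "\<dots> \<le> 2 * max_degree (T1 \<box> T2)"
    using max_degree_cartesian_product_ge[OF T1.pair_graph T2.pair_graph ne] by simp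
  finally show ?thesis .
qed

end
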